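(* Assume that $\varphi$ is differentiable. Then for every $Q\in\mathcal{M}_{\mathcal{F}}$ such that $\phi(Q,P)$ is finite and $\varphi'\left(\frac{dQ}{dP}\right)$ belongs to $\langle\mathcal{F}\cup\mathcal{B}_b\rangle$, the $\phi$-divergence $\phi(Q,P)$ admits the dual representation $$\phi(Q,P)=\sup_{f\in\langle\mathcal{F}\cup\mathcal{B}_b\rangle}\left\{\int f\,dQ-\int\varphi^*(f)\,dP\right\},$$ and the function $\overline{f}:=\varphi'\left(\frac{dQ}{dP}\right)$ is a dual optimal solution, i.e. it attains this supremum. Furthermore, if $\varphi$ is essentially smooth, then $\overline{f}$ is the unique dual optimal solution ($P$-a.e.).
   Context: $(\mathcal{X},\mathcal{B})$ is a measurable space and $P$ a given probability measure on it. $\mathcal{M}$ is the real vector space of all signed finite measures on $(\mathcal{X},\mathcal{B})$, and $\mathcal{M}(P)$ the subspace of those absolutely continuous w.r.t. $P$. The function $\varphi:\mathbb{R}\to[0,+\infty]$ is proper, convex and closed, with $\varphi(1)=0$, and its domain $\{x:\varphi(x)<\infty\}$ is an interval with endpoints $a_\varphi<1<b_\varphi$ (finite or infinite). Closed means that $\varphi(x)\to\varphi(a_\varphi)$ as $x\downarrow a_\varphi$ if $a_\varphi$ is finite, and $\varphi(x)\to\varphi(b_\varphi)$ as $x\uparrow b_\varphi$ if $b_\varphi$ is finite (equivalently, $\varphi$ is lower semi-continuous). "Differentiable" means differentiable on $]a_\varphi,b_\varphi[$; then $\varphi'(a_\varphi)$ and $\varphi'(b_\varphi)$ denote the (finite or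 infinite) limits of $\varphi'(x)$ as $x\downarrow a_\varphi$ and $x\uparrow b_\varphi$. $\varphi$ is essentially smooth if it is differentiable with $\varphi'(a_\varphi)=-\infty$ when $a_\varphi>-\infty$ and $\varphi'(b_\varphi)=+\infty$ when $b_\varphi<+\infty$. The conjugate is $\varphi^*(t):=\sup_{x\in\mathbb{R}}\{tx-\varphi(x)\}$. For $Q\in\mathcal{M}(P)$ put $\phi(Q,P):=\int_{\mathcal{X}}\varphi\left(\frac{dQ}{dP}\right)dP$, and $\phi(Q,P):=+\infty$ if $Q\in\mathcal{M}\setminus\mathcal{M}(P)$. $\mathcal{F}$ is a class (not assumed finite) of measurable real valued functions on $\mathcal{X}$; $\mathcal{B}_b$ is the set of all bounded measurable real valued functions on $\mathcal{X}$; $\langle\mathcal{F}\cup\mathcal{B}_b\rangle$ is the linear span of $\mathcal{F}\cup\mathcal{B}_b$; $\mathcal{M}_{\mathcal{F}}:=\{Q\in\mathcal{M}:\int|f|\,d|Q|<\infty\text{ for all }f\in\mathcal{F}\}$, where $|Q|$ is the total variation of $Q$. When some $Q_0\in\mathcal{M}_{\mathcal{F}}$ has $\phi(Q_0,P)<\infty$, the integral $\int\varphi^*(f)\,dP$ is well defined in $(-\infty,+\infty]$ for all $f\in\langle\mathcal{F}\cup\mathcal{B}_b\rangle$. *)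

theory Defs
  imports "HOL-Probability.Probability" "HOL-Library.Function_Algebras"
begin

section \<open>Finite signed measures\<close>

text \<open>A finite signed measure on the measurable space underlying \<open>M\<close> is a real-valued set function;
  its values outside \<open>sets M\<close> are irrelevant.\<close>

definition signed_measure :: "'a measure \<Rightarrow> ('a set \<Rightarrow> real) \<Rightarrow> bool" where
  "signed_measure M Q \<longleftrightarrow> Q {} = 0 \<and>
     (\<forall>A :: nat \<Rightarrow> 'a set. range A \<subseteq> sets M \<longrightarrow> disjoint_family A \<longrightarrow>
        (\<lambda>i. Q (A i)) sums Q (\<Union>i. A i))"

text \<open>Jordan decomposition \<open>Q = Q\<^sup>+ - Q\<^sup>-\<close>. The supremum is over a set containing
  \<open>Q {} = 0\<close>, so the truncation of negative values by \<^const>\<open>ennreal\<close> is harmless.\<close>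

definition upper_variation :: "'a measure \<Rightarrow> ('a set \<Rightarrow> real) \<Rightarrow> 'a measure" where
  "upper_variation M Q =
     measure_of (space M) (sets M) (\<lambda>A. SUP B \<in> {B \<in> sets M. B \<subseteq> A}. ennreal (Q B))"

definition lower_variation :: "'a measure \<Rightarrow> ('a set \<Rightarrow> real) \<Rightarrow> 'a measure" where
  "lower_variation M Q = upper_variation M (\<lambda>A. - Q A)"

definition total_variation :: "'a measure \<Rightarrow> ('a set \<Rightarrow> real) \<Rightarrow> 'a measure" where
  "total_variation M Q = measure_of (space M) (sets M)
     (\<lambda>A. emeasure (upper_variation M Q) A + emeasure (lower_variation M Q) A)"

definition signed_integral :: "'a measure \<Rightarrow> ('a set \<Rightarrow> real) \<Rightarrow> ('a \<Rightarrow> real) \<Rightarrow> real" where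
  "signed_integral M Q f =
     (\<integral>x. f x \<partial>upper_variation M Q) - (\<integral>x. f x \<partial>lower_variation M Q)"

definition signed_abs_cont :: "'a measure \<Rightarrow> ('a set \<Rightarrow> real) \<Rightarrow> bool" where
  "signed_abs_cont P Q \<longleftrightarrow> (\<forall>A \<in> null_sets P. Q A = 0)"

text \<open>The density \<open>dQ/dP\<close> of a \<open>P\<close>-absolutely continuous \<open>Q\<close>. It is determined only up to
  \<open>P\<close>-null sets, so it is to be used only in ways that do not depend on the version chosen.\<close>

definition signed_RN_deriv :: "'a measure \<Rightarrow> ('a set \<Rightarrow> real) \<Rightarrow> 'a \<Rightarrow> real" where
  "signed_RN_deriv P Q =
     (SOME q. integrable P q \<and> (\<forall>A \<in> sets P. Q A = set_lebesgue_integral P A q))"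

section \<open>The convex function and its conjugate\<close>

definition dom_lower :: "(real \<Rightarrow> ennreal) \<Rightarrow> ereal" where
  "dom_lower \<phi> = (INF x \<in> {x. \<phi> x < \<infinity>}. ereal x)"

definition dom_upper :: "(real \<Rightarrow> ennreal) \<Rightarrow> ereal" where
  "dom_upper \<phi> = (SUP x \<in> {x. \<phi> x < \<infinity>}. ereal x)"

definition ennreal_convex :: "(real \<Rightarrow> ennreal) \<Rightarrow> bool" where
  "ennreal_convex \<phi> \<longleftrightarrow> (\<forall>x y. \<forall>t \<in> {0..1}.
     \<phi> ((1 - t) * x + t * y) \<le> ennreal (1 - t) * \<phi> x + ennreal t * \<phi> y)"

definition closed_at_endpoints :: "(real \<Rightarrow> ennreal) \<Rightarrow> bool" where
  "closed_at_endpoints \<phi> \<longleftrightarrow>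
     (\<forall>a. dom_lower \<phi> = ereal a \<longrightarrow> (\<phi> \<longlongrightarrow> \<phi> a) (at_right a)) \<and>
     (\<forall>b. dom_upper \<phi> = ereal b \<longrightarrow> (\<phi> \<longlongrightarrow> \<phi> b) (at_left b))"

text \<open>Properness, and that the domain is an interval, follow from the conditions below.\<close>

definition divergence_function :: "(real \<Rightarrow> ennreal) \<Rightarrow> bool" where
  "divergence_function \<phi> \<longleftrightarrow> ennreal_convex \<phi> \<and> closed_at_endpoints \<phi> \<and>
     \<phi> 1 = 0 \<and> dom_lower \<phi> < 1 \<and> 1 < dom_upper \<phi>"

definition differentiable_on_dom :: "(real \<Rightarrow> ennreal) \<Rightarrow> bool" where
  "differentiable_on_dom \<phi> \<longleftrightarrow> (\<forall>x. dom_lower \<phi> < ereal x \<longrightarrow> ereal x < dom_upper \<phi> \<longrightarrow>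
     (\<lambda>y. enn2real (\<phi> y)) differentiable (at x))"

text \<open>The derivative, extended by one-sided limits to the finite endpoints of the domain. Its values
  outside the closure of the domain have no meaning.\<close>

definition ext_deriv :: "(real \<Rightarrow> ennreal) \<Rightarrow> real \<Rightarrow> ereal" where
  "ext_deriv \<phi> x =
     (if ereal x = dom_lower \<phi> then Lim (at_right x) (\<lambda>y. ereal (deriv (\<lambda>z. enn2real (\<phi> z)) y))
      else if ereal x = dom_upper \<phi> then Lim (at_left x) (\<lambda>y. ereal (deriv (\<lambda>z. enn2real (\<phi> z)) y))
      else ereal (deriv (\<lambda>z. enn2real (\<phi> z)) x))"

definition essentially_smooth :: "(real \<Rightarrow> ennreal) \<Rightarrow> bool" where
  "essentially_smooth \<phi> \<longleftrightarrow> differentiable_on_dom \<phi> \<and>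
     (\<forall>a. dom_lower \<phi> = ereal a \<longrightarrow> ext_deriv \<phi> a = - \<infinity>) \<and>
     (\<forall>b. dom_upper \<phi> = ereal b \<longrightarrow> ext_deriv \<phi> b = \<infinity>)"

definition conjugate :: "(real \<Rightarrow> ennreal) \<Rightarrow> real \<Rightarrow> ereal" where
  "conjugate \<phi> t = (SUP x. ereal (t * x) - enn2ereal (\<phi> x))"

section \<open>Divergences and the dual problem\<close>

definition phi_divergence :: "(real \<Rightarrow> ennreal) \<Rightarrow> ('a set \<Rightarrow> real) \<Rightarrow> 'a measure \<Rightarrow> ennreal" where
  "phi_divergence \<phi> Q P =
     (if signed_abs_cont P Q then \<integral>\<^sup>+ x. \<phi> (signed_RN_deriv P Q x) \<partial>P else \<infinity>)"

definition signed_measures_integrating :: "'a measure \<Rightarrow> ('a \<Rightarrow> real) set \<Rightarrow> ('a set \<Rightarrow> real) set" where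
  "signed_measures_integrating M F =
     {Q. signed_measure M Q \<and>
         (\<forall>f \<in> F. (\<integral>\<^sup>+ x. ennreal \<bar>f x\<bar> \<partial>total_variation M Q) < \<infinity>)}"

definition bounded_measurable :: "'a measure \<Rightarrow> ('a \<Rightarrow> real) set" where
  "bounded_measurable M = {f \<in> borel_measurable M. bounded (f ` space M)}"

definition fun_span :: "('a \<Rightarrow> real) set \<Rightarrow> ('a \<Rightarrow> real) set" where
  "fun_span = module.span (\<lambda>c f x. c * f x)"

text \<open>The integral of an extended-real function as the difference of the integrals of its positive
  and negative parts (\<^const>\<open>e2ennreal\<close> sends negative numbers to \<open>0\<close>); meaningful when at most one
  of them is infinite.\<close>

definition ereal_integral :: "'a measure \<Rightarrow> ('a \<Rightarrow> ereal) \<Rightarrow> ereal" where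
  "ereal_integral M g =
     enn2ereal (\<integral>\<^sup>+ x. e2ennreal (g x) \<partial>M) - enn2ereal (\<integral>\<^sup>+ x. e2ennreal (- g x) \<partial>M)"

definition dual_objective ::
  "(real \<Rightarrow> ennreal) \<Rightarrow> 'a measure \<Rightarrow> ('a set \<Rightarrow> real) \<Rightarrow> ('a \<Rightarrow> real) \<Rightarrow> ereal" where
  "dual_objective \<phi> P Q f =
     ereal (signed_integral P Q f) - ereal_integral P (\<lambda>x. conjugate \<phi> (f x))"

definition dual_optimal ::
  "(real \<Rightarrow> ennreal) \<Rightarrow> 'a measure \<Rightarrow> ('a \<Rightarrow> real) set \<Rightarrow> ('a set \<Rightarrow> real) \<Rightarrow> ('a \<Rightarrow> real) \<Rightarrow> bool" where
  "dual_optimal \<phi> P F Q f \<longleftrightarrow>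
     f \<in> fun_span (F \<union> bounded_measurable P) \<and>
     dual_objective \<phi> P Q f =
       (SUP g \<in> fun_span (F \<union> bounded_measurable P). dual_objective \<phi> P Q g)"

end

theory Submission
  imports Defs
begin

text \<open>
  Let \<open>q\<close> be the density of \<open>Q\<close> with respect to \<open>P\<close>. For every \<open>f\<close> in the span, \<open>f q\<close> is
  \<open>P\<close>-integrable and \<open>\<integral>f dQ = \<integral>f q dP\<close>. The Fenchel-Young inequality
  \<open>f q - \<phi>(q) \<le> \<phi>\<^sup>*(f)\<close> holds wherever \<open>\<phi>(q)\<close> is finite, that is almost everywhere, and its
  left-hand side is integrable. Hence \<open>\<integral>\<phi>\<^sup>*(f) dP\<close> splits off this minorant, and
  \<open>\<integral>f dQ - \<integral>\<phi>\<^sup>*(f) dP = \<phi>(Q,P) - \<integral>(\<phi>\<^sup>*(f) - f q + \<phi>(q)) dP\<close>.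
  The last integrand is nonnegative (\<open>duality_gap\<close>), so no \<open>f\<close> exceeds the divergence, and \<open>f\<close>
  attains it exactly when the integrand vanishes almost everywhere, which means that \<open>f(x)\<close> is a
  subgradient of \<open>\<phi>\<close> at \<open>q(x)\<close> for almost every \<open>x\<close> (\<open>gap_eq_0_iff\<close>).

  What remains is a statement about \<open>\<phi>\<close> alone. The extended derivative, where finite, is a
  subgradient: in the interior of the domain by convexity, at an endpoint by passing to the limit
  (\<open>ext_deriv_subgradient\<close>). Thus \<open>\<phi>'(q)\<close> attains the supremum. If \<open>\<phi>\<close> is essentially smooth,
  finiteness of \<open>\<phi>'(q)\<close> keeps \<open>q\<close> away from the endpoints almost everywhere, and at an interior
  point the derivative is the only subgradient (\<open>essentially_smooth_unique_subgradient\<close>), whence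
  uniqueness.

  The density is supplied by a Radon--Nikodym theorem for signed measures
  (\<open>signed_radon_nikodym\<close>). It rests on the boundedness of finite signed measures and the countable
  additivity of the upper variation. The upper, lower and total variations of \<open>Q\<close> then have the
  densities \<open>q\<^sup>+\<close>, \<open>q\<^sup>-\<close> and \<open>\<bar>q\<bar>\<close>, which turns integrals with respect to them into integrals of \<open>f q\<close>
  and \<open>\<bar>f q\<bar>\<close> with respect to \<open>P\<close>.
\<close>

section \<open>Convex functions: subgradients and Fenchel equality\<close>

definition dom_interior :: "(real \<Rightarrow> ennreal) \<Rightarrow> real set" where
  "dom_interior \<phi> = {x. dom_lower \<phi> < ereal x \<and> ereal x < dom_upper \<phi>}"

lemma open_dom_interior: "open (dom_interior \<phi>)"
  unfolding dom_interior_def by (intro open_Collect_conj open_Collect_less continuous_intros)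

lemma dom_bounds:
  assumes "\<phi> x < \<infinity>"
  shows "dom_lower \<phi> \<le> ereal x" "ereal x \<le> dom_upper \<phi>"
  using assms by (auto simp: dom_lower_def dom_upper_def intro!: INF_lower SUP_upper)

lemma ennreal_convex_real:
  assumes "ennreal_convex \<phi>" "\<phi> x < \<infinity>" "\<phi> y < \<infinity>" "0 \<le> t" "t \<le> 1"
  shows "\<phi> ((1 - t) * x + t * y) < \<infinity>"
    and "enn2real (\<phi> ((1 - t) * x + t * y)) \<le> (1 - t) * enn2real (\<phi> x) + t * enn2real (\<phi> y)"
proof -
  have fin: "\<phi> x = ennreal (enn2real (\<phi> x))" "\<phi> y = ennreal (enn2real (\<phi> y))"
    using assms(2,3) by (simp_all add: less_top)
  have "\<phi> ((1 - t) * x + t * y) \<le> ennreal (1 - t) * \<phi> x + ennreal t * \<phi> y"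
    using assms(1,4,5) by (auto simp: ennreal_convex_def)
  also have "\<dots> = ennreal ((1 - t) * enn2real (\<phi> x) + t * enn2real (\<phi> y))"
    using assms(4,5) by (subst fin(1), subst fin(2)) (simp add: ennreal_mult ennreal_plus)
  finally have *: "\<phi> ((1 - t) * x + t * y) \<le> ennreal ((1 - t) * enn2real (\<phi> x) + t * enn2real (\<phi> y))" .
  then show "\<phi> ((1 - t) * x + t * y) < \<infinity>"
    using le_less_trans by fastforce
  show "enn2real (\<phi> ((1 - t) * x + t * y)) \<le> (1 - t) * enn2real (\<phi> x) + t * enn2real (\<phi> y)"
    using * assms(4,5) by (intro enn2real_leI) auto
qed

lemma between_convex_combination:
  fixes x y z :: real
  assumes "x \<le> y" "y \<le> z"
  obtains t where "0 \<le> t" "t \<le> 1" "y = (1 - t) * x + t * z"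
proof (cases "x = z")
  case True
  then show ?thesis using that[of 0] assms by auto
next
  case False
  then have "x < z" using assms by auto
  define t where "t = (y - x) / (z - x)"
  have "t * (z - x) = y - x" using \<open>x < z\<close> by (simp add: t_def)
  then have "y = (1 - t) * x + t * z" by (simp add: algebra_simps)
  moreover have "0 \<le> t" "t \<le> 1" using assms \<open>x < z\<close> by (simp_all add: t_def)
  ultimately show ?thesis using that by blast
qed

lemma dom_interior_finite:
  assumes "ennreal_convex \<phi>" "x \<in> dom_interior \<phi>"
  shows "\<phi> x < \<infinity>"
proof -
  obtain y z where yz: "\<phi> y < \<infinity>" "y < x" "\<phi> z < \<infinity>" "x < z"
    using assms(2) by (auto simp: dom_interior_def dom_lower_def dom_upper_def INF_less_iff less_SUP_iff)
  obtain t where "0 \<le> t" "t \<le> 1" "x = (1 - t) * y + t * z"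
    using between_convex_combination[of y x z] yz by auto
  then show ?thesis using ennreal_convex_real(1)[OF assms(1) yz(1,3)] by auto
qed

text \<open>Sublevel sets of a convex function are intervals.\<close>

lemma ennreal_convex_borel:
  assumes "ennreal_convex \<phi>"
  shows "\<phi> \<in> borel_measurable borel"
proof (rule borel_measurableI_le)
  fix c :: ennreal
  have "is_interval {x. \<phi> x \<le> c}"
    unfolding is_interval_1
  proof (intro ballI allI impI)
    fix x z y assume *: "x \<in> {x. \<phi> x \<le> c}" "z \<in> {x. \<phi> x \<le> c}" "x \<le> y \<and> y \<le> z"
    then obtain t where t: "0 \<le> t" "t \<le> 1" "y = (1 - t) * x + t * z"
      using between_convex_combination by blast
    have "\<phi> y \<le> ennreal (1 - t) * \<phi> x + ennreal t * \<phi> z"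
      using assms t by (auto simp: ennreal_convex_def)
    also have "\<dots> \<le> ennreal (1 - t) * c + ennreal t * c"
      using * by (intro add_mono mult_left_mono) auto
    also have "\<dots> = ennreal (1 - t + t) * c"
      using t by (subst ennreal_plus) (auto simp: distrib_right)
    finally show "y \<in> {x. \<phi> x \<le> c}" by simp
  qed
  from real_interval_borel_measurable[OF this]
  show "{x \<in> space borel. \<phi> x \<le> c} \<in> sets borel" by simp
qed

text \<open>The conjugate is a supremum of affine functions, hence lower semicontinuous. The supremum is
  uncountable, so measurability is obtained from the superlevel sets being open.\<close>

lemma conjugate_borel: "conjugate \<phi> \<in> borel_measurable borel"
proof (rule borel_measurableI_greater)
  fix c :: ereal
  have "open {t. c < ereal (t * x) - enn2ereal (\<phi> x)}" for x
  proof (cases "\<phi> x")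
    case (real r)
    then show ?thesis
      by (auto simp: enn2ereal_ennreal intro!: open_Collect_less continuous_intros)
  qed simp
  then have "open (\<Union>x. {t. c < ereal (t * x) - enn2ereal (\<phi> x)})" by blast
  moreover have "{t \<in> space borel. c < conjugate \<phi> t} = (\<Union>x. {t. c < ereal (t * x) - enn2ereal (\<phi> x)})"
    by (auto simp: conjugate_def less_SUP_iff)
  ultimately show "{t \<in> space borel. c < conjugate \<phi> t} \<in> sets borel" by simp
qed

lemma fenchel_young:
  assumes "\<phi> x < \<infinity>"
  shows "ereal (t * x - enn2real (\<phi> x)) \<le> conjugate \<phi> t"
proof -
  obtain r where "\<phi> x = ennreal r" "0 \<le> r" using assms by (cases "\<phi> x") auto
  then have "ereal (t * x - enn2real (\<phi> x)) = ereal (t * x) - enn2ereal (\<phi> x)"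
    by (simp add: enn2ereal_ennreal)
  then show ?thesis by (auto simp: conjugate_def intro!: SUP_upper)
qed

text \<open>Meaningful only where \<open>\<phi> x\<close> is finite, because \<^const>\<open>enn2real\<close> sends \<open>\<infinity>\<close> to \<open>0\<close>.\<close>

definition subgradient :: "(real \<Rightarrow> ennreal) \<Rightarrow> real \<Rightarrow> real \<Rightarrow> bool" where
  "subgradient \<phi> x s \<longleftrightarrow>
     (\<forall>y. \<phi> y < \<infinity> \<longrightarrow> enn2real (\<phi> x) + s * (y - x) \<le> enn2real (\<phi> y))"

text \<open>Equality in the Fenchel-Young inequality at \<open>(x, t)\<close> says that \<open>t * y - \<phi> y\<close> is maximal at
  \<open>y = x\<close>, which is the subgradient inequality rearranged. Optimality in the dual problem is
  read off pointwise from this equivalence.\<close>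

lemma fenchel_equality_iff:
  assumes "\<phi> x < \<infinity>"
  shows "conjugate \<phi> t = ereal (t * x - enn2real (\<phi> x)) \<longleftrightarrow> subgradient \<phi> x t"
proof
  assume eq: "conjugate \<phi> t = ereal (t * x - enn2real (\<phi> x))"
  show "subgradient \<phi> x t"
    unfolding subgradient_def
  proof (intro allI impI)
    fix y assume "\<phi> y < \<infinity>"
    from fenchel_young[of \<phi> y t, OF this] eq
    show "enn2real (\<phi> x) + t * (y - x) \<le> enn2real (\<phi> y)" by (simp add: algebra_simps)
  qed
next
  assume sub: "subgradient \<phi> x t"
  have "ereal (t * y) - enn2ereal (\<phi> y) \<le> ereal (t * x - enn2real (\<phi> x))" for y
  proof (cases "\<phi> y")
    case (real r)
    then have "enn2real (\<phi> x) + t * (y - x) \<le> r"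
      using sub[unfolded subgradient_def, rule_format, of y] by simp
    with real show ?thesis by (simp add: enn2ereal_ennreal algebra_simps)
  qed simp
  then have "conjugate \<phi> t \<le> ereal (t * x - enn2real (\<phi> x))"
    by (auto simp: conjugate_def intro: SUP_least)
  with fenchel_young[of \<phi> x t, OF assms] show "conjugate \<phi> t = ereal (t * x - enn2real (\<phi> x))"
    by (simp add: antisym)
qed

lemma dom_interior_DERIV:
  assumes "differentiable_on_dom \<phi>" "x \<in> dom_interior \<phi>"
  shows "DERIV (\<lambda>z. enn2real (\<phi> z)) x :> deriv (\<lambda>z. enn2real (\<phi> z)) x"
  using assms by (auto simp: differentiable_on_dom_def dom_interior_def
      intro!: DERIV_deriv_iff_real_differentiable[THEN iffD2])

text \<open>On the segment from \<open>x\<close> to \<open>y\<close>, convexity bounds the difference quotients at \<open>x\<close> by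
  \<open>\<phi> y - \<phi> x\<close>, and the quotients tend to the derivative in the direction \<open>y - x\<close>. Here
  \<open>y\<close> may be an endpoint of the domain, where \<open>\<phi>\<close> need not be differentiable.\<close>

lemma deriv_subgradient:
  assumes "ennreal_convex \<phi>" "differentiable_on_dom \<phi>" "x \<in> dom_interior \<phi>"
  shows "subgradient \<phi> x (deriv (\<lambda>z. enn2real (\<phi> z)) x)"
  unfolding subgradient_def
proof (intro allI impI)
  fix y assume y: "\<phi> y < \<infinity>"
  let ?g = "\<lambda>z. enn2real (\<phi> z)"
  define h where "h t = ?g ((1 - t) * x + t * y)" for t
  have "DERIV h 0 :> deriv ?g x * (y - x)"
    unfolding h_def
    by (rule DERIV_chain'[where f="\<lambda>t. (1 - t) * x + t * y" and g="?g", THEN DERIV_cong])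
      (auto intro!: derivative_eq_intros dom_interior_DERIV assms(2,3))
  then have "((\<lambda>t. (h t - h 0) / t) \<longlongrightarrow> deriv ?g x * (y - x)) (at_right 0)"
    by (auto simp: DERIV_def intro: tendsto_within_subset)
  moreover have "\<forall>\<^sub>F t in at_right 0. (h t - h 0) / t \<le> ?g y - ?g x"
  proof -
    have "(h t - h 0) / t \<le> ?g y - ?g x" if "0 < t" "t < 1" for t
    proof -
      have "h t \<le> (1 - t) * ?g x + t * ?g y"
        unfolding h_def using that dom_interior_finite[OF assms(1,3)] y
        by (intro ennreal_convex_real(2)[OF assms(1)]) auto
      then show ?thesis using that by (simp add: h_def field_simps)
    qed
    then show ?thesis
      using eventually_at_right_field[of _ "0::real"] by (auto intro!: exI[of _ 1])
  qed
  ultimately have "deriv ?g x * (y - x) \<le> ?g y - ?g x"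
    by (rule tendsto_upperbound) simp
  then show "?g x + deriv ?g x * (y - x) \<le> ?g y" by simp
qed

text \<open>A subgradient \<open>s\<close> at \<open>x\<close> makes \<open>y \<mapsto> \<phi> y - s * y\<close> minimal at \<open>x\<close>, and the derivative
  vanishes at an interior minimum.\<close>

lemma subgradient_eq_deriv:
  assumes "ennreal_convex \<phi>" "differentiable_on_dom \<phi>" "x \<in> dom_interior \<phi>" "subgradient \<phi> x s"
  shows "s = deriv (\<lambda>z. enn2real (\<phi> z)) x"
proof -
  let ?g = "\<lambda>z. enn2real (\<phi> z)"
  obtain d where d: "0 < d" "\<And>y. dist y x < d \<Longrightarrow> y \<in> dom_interior \<phi>"
    using open_dom_interior assms(3) unfolding open_dist by blast
  have "DERIV (\<lambda>y. ?g y - s * y) x :> deriv ?g x - s"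
    by (auto intro!: derivative_eq_intros dom_interior_DERIV assms)
  moreover have "\<forall>y. \<bar>x - y\<bar> < d \<longrightarrow> ?g x - s * x \<le> ?g y - s * y"
  proof (intro allI impI)
    fix y assume "\<bar>x - y\<bar> < d"
    then have "\<phi> y < \<infinity>"
      using d(2)[of y] dom_interior_finite[OF assms(1)] by (auto simp: dist_real_def abs_minus_commute)
    then have "?g x + s * (y - x) \<le> ?g y"
      using assms(4) by (auto simp: subgradient_def)
    then show "?g x - s * x \<le> ?g y - s * y" by (simp add: algebra_simps)
  qed
  ultimately have "deriv ?g x - s = 0"
    using d(1) by (intro DERIV_local_min)
  then show ?thesis by simp
qed

lemma deriv_mono_on_dom_interior:
  assumes "ennreal_convex \<phi>" "differentiable_on_dom \<phi>"
  shows "mono_on (dom_interior \<phi>) (deriv (\<lambda>z. enn2real (\<phi> z)))"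
proof (rule mono_onI)
  fix x y assume xy: "x \<in> dom_interior \<phi>" "y \<in> dom_interior \<phi>" "x \<le> y"
  let ?g = "\<lambda>z. enn2real (\<phi> z)"
  have "?g x + deriv ?g x * (y - x) \<le> ?g y" "?g y + deriv ?g y * (x - y) \<le> ?g x"
    using deriv_subgradient[OF assms] dom_interior_finite[OF assms(1)] xy
    by (auto simp: subgradient_def)
  then have "(deriv ?g x - deriv ?g y) * (y - x) \<le> 0" by (simp add: algebra_simps)
  then show "deriv ?g x \<le> deriv ?g y"
    using xy(3) by (cases "x = y") (auto simp: mult_le_0_iff)
qed

lemma mono_on_tendsto_at_right:
  fixes f :: "real \<Rightarrow> 'b :: {complete_linorder, linorder_topology}"
  assumes "a < b" "mono_on {a<..<b} f"
  shows "(f \<longlongrightarrow> (INF x\<in>{a<..<b}. f x)) (at_right a)"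
proof (rule order_tendstoI)
  fix l assume "l < (INF x\<in>{a<..<b}. f x)"
  then have "l < f x" if "a < x" "x < b" for x
    using that by (meson INF_lower greaterThanLessThan_iff less_le_trans)
  then show "\<forall>\<^sub>F x in at_right a. l < f x"
    using assms(1) by (auto simp: eventually_at_right_field)
next
  fix u assume "(INF x\<in>{a<..<b}. f x) < u"
  then obtain c where c: "a < c" "c < b" "f c < u" by (auto simp: INF_less_iff)
  then have "f x < u" if "a < x" "x < c" for x
    using that mono_onD[OF assms(2), of x c] by (auto intro: le_less_trans)
  then show "\<forall>\<^sub>F x in at_right a. f x < u"
    using c by (auto simp: eventually_at_right_field)
qed

lemma mono_on_tendsto_at_left:
  fixes f :: "real \<Rightarrow> 'b :: {complete_linorder, linorder_topology}"
  assumes "a < b" "mono_on {a<..<b} f"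
  shows "(f \<longlongrightarrow> (SUP x\<in>{a<..<b}. f x)) (at_left b)"
proof (rule order_tendstoI)
  fix u assume "(SUP x\<in>{a<..<b}. f x) < u"
  then have "f x < u" if "a < x" "x < b" for x
    using that by (meson SUP_upper greaterThanLessThan_iff le_less_trans)
  then show "\<forall>\<^sub>F x in at_left b. f x < u"
    using assms(1) by (auto simp: eventually_at_left_field)
next
  fix l assume "l < (SUP x\<in>{a<..<b}. f x)"
  then obtain c where c: "a < c" "c < b" "l < f c" by (auto simp: less_SUP_iff)
  then have "l < f x" if "c < x" "x < b" for x
    using that mono_onD[OF assms(2), of c x] by (auto intro: less_le_trans)
  then show "\<forall>\<^sub>F x in at_left b. l < f x"
    using c by (auto simp: eventually_at_left_field)
qed

text \<open>The subgradient inequality is closed under limits along which \<open>\<phi>\<close> and its derivative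
  converge. Closedness of \<open>\<phi>\<close> provides the former at the endpoints of the domain.\<close>

lemma subgradient_limit:
  assumes "ennreal_convex \<phi>" "differentiable_on_dom \<phi>" "L \<noteq> bot"
    and lim: "(\<phi> \<longlongrightarrow> \<phi> x) L" "((\<lambda>z. z) \<longlongrightarrow> x) L"
      "(deriv (\<lambda>z. enn2real (\<phi> z)) \<longlongrightarrow> s) L"
    and ev: "\<forall>\<^sub>F z in L. z \<in> dom_interior \<phi>" and "\<phi> x < \<infinity>"
  shows "subgradient \<phi> x s"
  unfolding subgradient_def
proof (intro allI impI)
  fix y assume y: "\<phi> y < \<infinity>"
  let ?g = "\<lambda>z. enn2real (\<phi> z)"
  have "(?g \<longlongrightarrow> ?g x) L"
    using lim(1) \<open>\<phi> x < \<infinity>\<close> tendsto_enn2real[of \<phi> "enn2real (\<phi> x)" L] by simp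
  then have "((\<lambda>z. ?g z + deriv ?g z * (y - z)) \<longlongrightarrow> ?g x + s * (y - x)) L"
    by (intro tendsto_add tendsto_mult tendsto_diff tendsto_const lim)
  moreover have "\<forall>\<^sub>F z in L. ?g z + deriv ?g z * (y - z) \<le> ?g y"
    using ev by eventually_elim (use deriv_subgradient[OF assms(1,2)] y in \<open>auto simp: subgradient_def\<close>)
  ultimately show "?g x + s * (y - x) \<le> ?g y"
    using assms(3) by (intro tendsto_upperbound)
qed

text \<open>Existence of the one-sided limits in \<^const>\<open>ext_deriv\<close> comes from monotonicity of the
  derivative. The limits are taken in the extended reals, and the assumption says that the limit
  is finite.\<close>

lemma ext_deriv_subgradient:
  assumes df: "divergence_function \<phi>" and diff: "differentiable_on_dom \<phi>"
    and x: "\<phi> x < \<infinity>" and s: "ext_deriv \<phi> x = ereal s"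
  shows "subgradient \<phi> x s"
proof -
  let ?g = "\<lambda>z. enn2real (\<phi> z)"
  have cvx: "ennreal_convex \<phi>" and cl: "closed_at_endpoints \<phi>"
    and one: "dom_lower \<phi> < 1" "1 < dom_upper \<phi>"
    using df by (auto simp: divergence_function_def)
  have mono: "mono_on S (\<lambda>z. ereal (deriv ?g z))" if "S \<subseteq> dom_interior \<phi>" for S
    using mono_on_subset[OF deriv_mono_on_dom_interior[OF cvx diff] that]
    by (auto simp: mono_on_def)
  consider (low) "ereal x = dom_lower \<phi>" | (upp) "ereal x = dom_upper \<phi>" "ereal x \<noteq> dom_lower \<phi>"
    | (int) "x \<in> dom_interior \<phi>" "ereal x \<noteq> dom_lower \<phi>" "ereal x \<noteq> dom_upper \<phi>"
    using dom_bounds[of \<phi> x, OF x] by (fastforce simp: dom_interior_def)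
  then show ?thesis
  proof cases
    case low
    then have "x < 1" using one by (metis ereal_less(3) less_ereal.simps(1) one_ereal_def)
    \<comment> \<open>The point 1 is interior to the domain, which gives an interval next to the endpoint \<open>x\<close>.\<close>
    have sub: "{x<..<1} \<subseteq> dom_interior \<phi>"
      unfolding dom_interior_def low[symmetric]
      using less_trans[OF _ one(2), of "ereal _"] by (auto simp: one_ereal_def)
    have Lim: "Lim (at_right x) (\<lambda>z. ereal (deriv ?g z)) = ereal s"
      using s unfolding ext_deriv_def if_P[OF low] .
    note L = mono_on_tendsto_at_right[OF \<open>x < 1\<close> mono[OF sub]]
    have "((\<lambda>z. ereal (deriv ?g z)) \<longlongrightarrow> ereal s) (at_right x)"
      using L tendsto_Lim[OF _ L] Lim by (metis trivial_limit_at_right_real)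
    moreover have "(\<phi> \<longlongrightarrow> \<phi> x) (at_right x)"
      using cl low[symmetric] using closed_at_endpoints_def by blast
    moreover have "\<forall>\<^sub>F z in at_right x. z \<in> dom_interior \<phi>"
      using eventually_at_right_real[OF \<open>x < 1\<close>] by (rule eventually_mono) (use sub in auto)
    ultimately show ?thesis
      using x
      by (intro subgradient_limit[OF cvx diff trivial_limit_at_right_real]) (simp_all only: lim_ereal tendsto_ident_at)
  next
    case upp
    then have "1 < x" using one by (metis less_ereal.simps(1) one_ereal_def)
    have sub: "{1<..<x} \<subseteq> dom_interior \<phi>"
      unfolding dom_interior_def upp(1)[symmetric]
      using less_trans[OF one(1), of "ereal _"] by (auto simp: one_ereal_def)
    have Lim: "Lim (at_left x) (\<lambda>z. ereal (deriv ?g z)) = ereal s"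
      using s unfolding ext_deriv_def if_not_P[OF upp(2)] if_P[OF upp(1)] .
    note L = mono_on_tendsto_at_left[OF \<open>1 < x\<close> mono[OF sub]]
    have "((\<lambda>z. ereal (deriv ?g z)) \<longlongrightarrow> ereal s) (at_left x)"
      using L tendsto_Lim[OF _ L] Lim by (metis trivial_limit_at_left_real)
    moreover have "(\<phi> \<longlongrightarrow> \<phi> x) (at_left x)"
      using cl upp(1)[symmetric] using closed_at_endpoints_def by blast
    moreover have "\<forall>\<^sub>F z in at_left x. z \<in> dom_interior \<phi>"
      using eventually_at_left_real[OF \<open>1 < x\<close>] by (rule eventually_mono) (use sub in auto)
    ultimately show ?thesis
      using x
      by (intro subgradient_limit[OF cvx diff trivial_limit_at_left_real]) (simp_all only: lim_ereal tendsto_ident_at)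
  next
    case int
    then show ?thesis
      using s deriv_subgradient[OF cvx diff int(1)] by (simp add: ext_deriv_def)
  qed
qed

text \<open>Essential smoothness makes the extended derivative infinite at a finite endpoint, so a point with
  a finite one is interior, and there the derivative is the only subgradient. At an endpoint with
  finite slope the subgradients would form a half-line.\<close>

lemma essentially_smooth_unique_subgradient:
  assumes "divergence_function \<phi>" "essentially_smooth \<phi>" "\<phi> x < \<infinity>"
    and "ext_deriv \<phi> x = ereal s" "subgradient \<phi> x t"
  shows "t = s"
proof -
  have cvx: "ennreal_convex \<phi>" and diff: "differentiable_on_dom \<phi>"
    using assms by (auto simp: divergence_function_def essentially_smooth_def)
  have ne: "ereal x \<noteq> dom_lower \<phi>" "ereal x \<noteq> dom_upper \<phi>"
    using assms(2,4) by (auto simp: essentially_smooth_def)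
  then have "x \<in> dom_interior \<phi>"
    using dom_bounds[of \<phi> x, OF assms(3)] by (auto simp: dom_interior_def)
  with subgradient_eq_deriv[OF cvx diff this assms(5)] ne assms(4)
  show ?thesis by (simp add: ext_deriv_def)
qed

section \<open>Radon--Nikodym theorem for signed measures\<close>

lemma signed_measure_Un:
  assumes "signed_measure M Q" "A \<in> sets M" "B \<in> sets M" "A \<inter> B = {}"
  shows "Q (A \<union> B) = Q A + Q B"
proof -
  have "disjoint_family (binaryset A B)"
    using assms(4) by (auto simp: disjoint_family_on_def binaryset_def)
  moreover have "range (binaryset A B) \<subseteq> sets M"
    using assms(2,3) by (auto simp: range_binaryset_eq)
  ultimately have "(\<lambda>i. Q (binaryset A B i)) sums Q (\<Union>i. binaryset A B i)"
    using assms(1) unfolding signed_measure_def by blast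
  then have "(\<lambda>i. Q (binaryset A B i)) sums Q (A \<union> B)"
    by (simp add: UN_binaryset_eq)
  moreover have "(\<lambda>i. Q (binaryset A B i)) sums (Q A + Q B)"
    using assms(1) by (intro binaryset_sums) (simp add: signed_measure_def)
  ultimately show ?thesis by (rule sums_unique2)
qed

lemma signed_measure_Diff:
  assumes "signed_measure M Q" "A \<in> sets M" "B \<in> sets M" "B \<subseteq> A"
  shows "Q (A - B) = Q A - Q B"
proof -
  have "(A - B) \<union> B = A" "(A - B) \<inter> B = {}" using assms(4) by auto
  then show ?thesis
    using signed_measure_Un[OF assms(1), of "A - B" B] assms(2,3) by auto
qed

text \<open>If the values on subsets of \<open>A\<close> are unbounded, then \<open>A\<close> splits into two parts with values
  larger than 1 in modulus, and one part again has unbounded values on its subsets. Iterating in that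
  part peels off disjoint sets with values larger than 1 in modulus, whose sum cannot converge.\<close>

lemma signed_measure_bounded:
  assumes Q: "signed_measure M Q"
  shows "\<exists>K. \<forall>A \<in> sets M. \<bar>Q A\<bar> \<le> K"
proof (rule ccontr)
  assume neg: "\<not> ?thesis"
  define unb where "unb A \<longleftrightarrow> A \<in> sets M \<and> (\<forall>K. \<exists>B \<in> sets M. B \<subseteq> A \<and> K < \<bar>Q B\<bar>)" for A
  have "unb (space M)"
    unfolding unb_def
  proof (intro conjI allI)
    fix K
    obtain B where "B \<in> sets M" "K < \<bar>Q B\<bar>" using neg by (meson not_le)
    then show "\<exists>B \<in> sets M. B \<subseteq> space M \<and> K < \<bar>Q B\<bar>"
      using sets.sets_into_space by blast
  qed simp
  moreover have "\<exists>E. unb E \<and> E \<subseteq> A \<and> 1 < \<bar>Q (A - E)\<bar>" if A: "unb A" for A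
  proof -
    have "A \<in> sets M" using A by (simp add: unb_def)
    \<comment> \<open>The margin \<open>\<bar>Q A\<bar>\<close> leaves the complement \<open>A - B\<close> with a value of modulus larger than 1 too.\<close>
    obtain B where B: "B \<in> sets M" "B \<subseteq> A" "\<bar>Q A\<bar> + 1 < \<bar>Q B\<bar>"
      using A unfolding unb_def by blast
    have "1 < \<bar>Q B\<bar>" using B(3) by simp
    have "1 < \<bar>Q (A - B)\<bar>"
      using B(3) signed_measure_Diff[OF Q \<open>A \<in> sets M\<close> B(1,2)] by simp
    have "unb B \<or> unb (A - B)"
    proof (rule ccontr)
      assume "\<not> ?thesis"
      then obtain K L where K: "\<And>C. C \<in> sets M \<Longrightarrow> C \<subseteq> B \<Longrightarrow> \<bar>Q C\<bar> \<le> K"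
        and L: "\<And>C. C \<in> sets M \<Longrightarrow> C \<subseteq> A - B \<Longrightarrow> \<bar>Q C\<bar> \<le> L"
        using B(1) \<open>A \<in> sets M\<close> unfolding unb_def by (force simp: not_less)
      obtain C where C: "C \<in> sets M" "C \<subseteq> A" "K + L < \<bar>Q C\<bar>"
        using A unfolding unb_def by blast
      have "Q C = Q (C \<inter> B) + Q (C - B)"
        using signed_measure_Un[OF Q, of "C \<inter> B" "C - B"] B(1) C(1) by (auto simp: Int_Diff_Un)
      then show False
        using K[of "C \<inter> B"] L[of "C - B"] B(1) C by force
    qed
    then show ?thesis
    proof
      assume "unb B"
      then show ?thesis using B(2) \<open>1 < \<bar>Q (A - B)\<bar>\<close> by blast
    next
      assume "unb (A - B)"
      moreover have "A - (A - B) = B" using B(2) by blast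
      ultimately show ?thesis using \<open>1 < \<bar>Q B\<bar>\<close> by (metis Diff_subset)
    qed
  qed
  ultimately obtain E where E: "\<And>n. unb (E n)" "\<And>n. E (Suc n) \<subseteq> E n" "\<And>n. 1 < \<bar>Q (E n - E (Suc n))\<bar>"
    using dependent_nat_choice[of "\<lambda>_. unb" "\<lambda>_ A E. E \<subseteq> A \<and> 1 < \<bar>Q (A - E)\<bar>"] by metis
  define D where "D n = E n - E (Suc n)" for n
  have "decseq E" using E(2) by (rule decseq_SucI)
  have "disjoint_family D"
    unfolding disjoint_family_on_def
  proof (intro ballI impI)
    fix m n :: nat assume "m \<noteq> n"
    then have "E n \<subseteq> E (Suc m) \<or> E m \<subseteq> E (Suc n)"
      using decseqD[OF \<open>decseq E\<close>] by (metis Suc_leI linorder_neqE_nat)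
    then show "D m \<inter> D n = {}" by (auto simp: D_def)
  qed
  moreover have "range D \<subseteq> sets M"
    using E(1) by (auto simp: D_def unb_def)
  ultimately have "(\<lambda>n. Q (D n)) sums Q (\<Union>n. D n)"
    using Q unfolding signed_measure_def by blast
  then have "(\<lambda>n. Q (D n)) \<longlonglongrightarrow> 0"
    by (intro summable_LIMSEQ_zero) (auto simp: summable_def)
  from LIMSEQ_D[OF this, of 1] obtain n where "\<bar>Q (D n)\<bar> < 1" by auto
  with E(3)[of n] show False by (simp add: D_def)
qed

lemma sets_upper_variation [simp]: "sets (upper_variation M Q) = sets M"
  and space_upper_variation [simp]: "space (upper_variation M Q) = space M"
  by (simp_all add: upper_variation_def sets.space_closed)

text \<open>The supremum in \<^const>\<open>upper_variation\<close> is countably additive, so \<^const>\<open>measure_of\<close> does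
  return it. It is superadditive on disjoint sets because near-optimal subsets can be united
  (a subset of negative value is discarded), and subadditive because a subset of the union splits
  into its parts.\<close>

lemma emeasure_upper_variation:
  assumes Q: "signed_measure M Q" and "A \<in> sets M"
  shows "emeasure (upper_variation M Q) A = (SUP B \<in> {B \<in> sets M. B \<subseteq> A}. ennreal (Q B))"
proof -
  define U where "U A = (SUP B \<in> {B \<in> sets M. B \<subseteq> A}. ennreal (Q B))" for A
  have U_upper: "ennreal (Q B) \<le> U A" if "B \<in> sets M" "B \<subseteq> A" for A B
    using that by (auto simp: U_def intro: SUP_upper)
  have U_least: "U A \<le> c" if "\<And>B. B \<in> sets M \<Longrightarrow> B \<subseteq> A \<Longrightarrow> ennreal (Q B) \<le> c" for A c
    using that by (auto simp: U_def intro: SUP_least)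
  have Q0: "Q {} = 0" using Q by (simp add: signed_measure_def)
  have U0: "U {} = 0" using U_least[of "{}" 0] Q0 by auto
  have super: "U A + U B \<le> U (A \<union> B)" if AB: "A \<inter> B = {}" for A B
  proof -
    have *: "ennreal (Q C) + ennreal (Q D) \<le> U (A \<union> B)"
      if CD: "C \<in> sets M" "C \<subseteq> A" "D \<in> sets M" "D \<subseteq> B" for C D
    proof (cases "0 \<le> Q C \<and> 0 \<le> Q D")
      case True
      have "Q (C \<union> D) = Q C + Q D"
        using CD AB by (intro signed_measure_Un[OF Q]) auto
      then have "ennreal (Q C) + ennreal (Q D) = ennreal (Q (C \<union> D))"
        using True by simp
      also have "\<dots> \<le> U (A \<union> B)" using CD by (intro U_upper) auto
      finally show ?thesis .
    next
      case False
      then have "ennreal (Q C) = 0 \<or> ennreal (Q D) = 0"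
        by (auto simp: ennreal_neg)
      moreover have "ennreal (Q C) \<le> U (A \<union> B)" "ennreal (Q D) \<le> U (A \<union> B)"
        using CD by (auto intro!: U_upper)
      ultimately show ?thesis by auto
    qed
    have ne: "{B \<in> sets M. B \<subseteq> A} \<noteq> {}" for A by auto
    have "U A + U B = (SUP D\<in>{B' \<in> sets M. B' \<subseteq> B}. U A + ennreal (Q D))"
      unfolding U_def[of B] by (rule ennreal_SUP_add_right[OF ne])
    also have "\<dots> = (SUP D\<in>{B' \<in> sets M. B' \<subseteq> B}. SUP C\<in>{A' \<in> sets M. A' \<subseteq> A}. ennreal (Q C) + ennreal (Q D))"
      unfolding U_def[of A] by (intro SUP_cong refl ennreal_SUP_add_left[OF ne, symmetric])
    also have "\<dots> \<le> U (A \<union> B)" by (intro SUP_least) (auto intro: *)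
    finally show ?thesis .
  qed
  have "countably_additive (sets M) U"
    unfolding countably_additive_def
  proof (intro allI impI)
    fix A :: "nat \<Rightarrow> _" assume A: "range A \<subseteq> sets M" "disjoint_family A"
    show "(\<Sum>i. U (A i)) = U (\<Union>i. A i)"
    proof (rule antisym)
      have "(\<Sum>i<n. U (A i)) \<le> U (\<Union>i<n. A i)" for n
      proof (induction n)
        case (Suc n)
        have "A i \<inter> A n = {}" if "i < n" for i
          using A(2) that by (simp add: disjoint_family_on_def)
        then have "(\<Union>i<n. A i) \<inter> A n = {}" by blast
        from super[OF this] Suc show ?case
          by (simp add: lessThan_Suc Un_commute add.commute) (meson add_left_mono order_trans)
      qed (simp add: U0)
      moreover have "U (\<Union>i<n. A i) \<le> U (\<Union>i. A i)" for n
        by (intro U_least U_upper) auto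
      ultimately show "(\<Sum>i. U (A i)) \<le> U (\<Union>i. A i)"
        by (intro suminf_le_const) (auto intro: order_trans)
    next
      show "U (\<Union>i. A i) \<le> (\<Sum>i. U (A i))"
      proof (rule U_least)
        fix B assume B: "B \<in> sets M" "B \<subseteq> (\<Union>i. A i)"
        have "disjoint_family (\<lambda>i. B \<inter> A i)"
          using A(2) by (auto simp: disjoint_family_on_def)
        moreover have "range (\<lambda>i. B \<inter> A i) \<subseteq> sets M" using A(1) B(1) by auto
        moreover have "(\<Union>i. B \<inter> A i) = B" using B(2) by auto
        ultimately have "(\<lambda>i. Q (B \<inter> A i)) sums Q B"
          using Q unfolding signed_measure_def by metis
        then have "(\<lambda>n. ennreal (\<Sum>i<n. Q (B \<inter> A i))) \<longlonglongrightarrow> ennreal (Q B)"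
          unfolding sums_def by (rule tendsto_ennrealI)
        moreover have "ennreal (\<Sum>i<n. Q (B \<inter> A i)) \<le> (\<Sum>i. U (A i))" for n
        proof -
          have "ennreal (\<Sum>i<n. Q (B \<inter> A i)) \<le> ennreal (\<Sum>i<n. max 0 (Q (B \<inter> A i)))"
            by (intro ennreal_leI sum_mono) simp
          also have "\<dots> = (\<Sum>i<n. ennreal (max 0 (Q (B \<inter> A i))))"
            by (rule sum_ennreal[symmetric]) simp
          also have "\<dots> = (\<Sum>i<n. ennreal (Q (B \<inter> A i)))"
            by (intro sum.cong refl) (simp add: max_def ennreal_neg)
          also have "\<dots> \<le> (\<Sum>i<n. U (A i))"
            using A(1) B(1) by (intro sum_mono U_upper) auto
          also have "\<dots> \<le> (\<Sum>i. U (A i))" by (rule sum_le_suminf) auto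
          finally show ?thesis .
        qed
        ultimately show "ennreal (Q B) \<le> (\<Sum>i. U (A i))"
          by (intro LIMSEQ_le_const2) auto
      qed
    qed
  qed
  moreover have "positive (sets M) U" using U0 by (simp add: positive_def)
  ultimately have "emeasure (upper_variation M Q) A = U A"
    using assms(2)
    by (intro emeasure_measure_of[where \<Omega>="space M" and A="sets M"])
      (auto simp: upper_variation_def U_def[abs_def] sets.space_closed)
  then show ?thesis by (simp add: U_def)
qed

lemma finite_measure_upper_variation:
  assumes Q: "signed_measure M Q"
  shows "finite_measure (upper_variation M Q)"
proof
  obtain K where K: "\<And>A. A \<in> sets M \<Longrightarrow> \<bar>Q A\<bar> \<le> K"
    using signed_measure_bounded[OF Q] by blast
  have "emeasure (upper_variation M Q) (space M) \<le> ennreal K"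
    using K by (auto simp: emeasure_upper_variation[OF Q] intro!: SUP_least ennreal_leI dest: abs_le_D1)
  then show "emeasure (upper_variation M Q) (space (upper_variation M Q)) \<noteq> \<infinity>"
    by (auto simp: top_unique)
qed

lemma finite_radon_nikodym:
  assumes "finite_measure P" "finite_measure N" "absolutely_continuous P N" "sets N = sets P"
  shows "\<exists>u. integrable P u \<and> (\<forall>A \<in> sets P. measure N A = set_lebesgue_integral P A u)"
proof -
  interpret P: finite_measure P by fact
  interpret N: finite_measure N by fact
  from P.real_RN_deriv[OF assms(2-4)] obtain D where D[measurable]: "D \<in> borel_measurable P"
    and AE: "AE x in P. RN_deriv P N x = ennreal (D x)" and nn: "\<And>x. 0 \<le> D x"
    by metis
  have N: "N = density P D"
    using P.density_RN_deriv[OF assms(3,4)] density_cong[OF _ _ AE] by simp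
  have eN: "emeasure N A = (\<integral>\<^sup>+ x. ennreal (indicator A x * D x) \<partial>P)" if "A \<in> sets P" for A
    using that by (auto simp: N emeasure_density nn indicator_def intro!: nn_integral_cong)
  have "(\<integral>\<^sup>+ x. ennreal (D x) \<partial>P) = emeasure N (space P)"
    by (auto simp: eN intro!: nn_integral_cong)
  also have "\<dots> < \<infinity>" by (simp add: N.emeasure_eq_measure)
  finally have int: "integrable P D"
    using nn by (simp add: integrable_iff_bounded)
  have "measure N A = set_lebesgue_integral P A D" if "A \<in> sets P" for A
    using that nn by (simp add: measure_def eN set_lebesgue_integral_def integral_eq_nn_integral)
  with int show ?thesis by blast
qed

text \<open>The classical theorem is applied to the two finite measures \<open>U\<close>, the upper variation, and
  \<open>L = U - Q\<close>, which is nonnegative because \<open>Q A\<close> is one of the values in the supremum \<open>U A\<close>.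
  Both inherit absolute continuity from \<open>Q\<close>, since \<open>Q\<close> vanishes on every measurable subset of a
  null set, and the difference of their densities is a density of \<open>Q\<close>.\<close>

lemma signed_radon_nikodym:
  assumes P: "finite_measure P" and Q: "signed_measure P Q" and ac: "signed_abs_cont P Q"
  shows "\<exists>q. integrable P q \<and> (\<forall>A \<in> sets P. Q A = set_lebesgue_integral P A q)"
proof -
  define U where "U = upper_variation P Q"
  interpret U: finite_measure U
    unfolding U_def by (rule finite_measure_upper_variation[OF Q])
  have sU: "sets U = sets P" by (simp add: U_def)
  have Q0: "Q {} = 0" using Q by (simp add: signed_measure_def)
  have le: "Q A \<le> measure U A" if "A \<in> sets P" for A
  proof -
    have "ennreal (Q A) \<le> emeasure U A"
      using that unfolding U_def by (subst emeasure_upper_variation[OF Q]) (auto intro: SUP_upper)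
    then show ?thesis by (simp add: U.emeasure_eq_measure)
  qed
  define L where "L = measure_of (space P) (sets P) (\<lambda>A. ennreal (measure U A - Q A))"
  have sL: "sets L = sets P" by (simp add: L_def)
  have eL: "emeasure L A = ennreal (measure U A - Q A)" if "A \<in> sets P" for A
  proof -
    have "countably_additive (sets P) (\<lambda>A. ennreal (measure U A - Q A))"
      unfolding countably_additive_def
    proof (intro allI impI)
      fix A :: "nat \<Rightarrow> _"
      assume A: "range A \<subseteq> sets P" "disjoint_family A"
      have "(\<lambda>i. measure U (A i) - Q (A i)) sums (measure U (\<Union>i. A i) - Q (\<Union>i. A i))"
        using A Q sU by (intro sums_diff U.finite_measure_UNION) (auto simp: signed_measure_def)
      then show "(\<Sum>i. ennreal (measure U (A i) - Q (A i))) = ennreal (measure U (\<Union>i. A i) - Q (\<Union>i. A i))"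
        using A(1) le by (intro suminf_ennreal_eq) auto
    qed
    moreover have "positive (sets P) (\<lambda>A. ennreal (measure U A - Q A))"
      using Q0 by (simp add: positive_def)
    ultimately show ?thesis
      using that by (intro emeasure_measure_of[OF L_def]) (simp_all add: sL sets.space_closed)
  qed
  have "space L = space P" by (simp add: L_def)
  then have finL: "finite_measure L"
    by (intro finite_measureI) (simp add: eL)
  have U_null: "emeasure U A = 0" if "A \<in> null_sets P" for A
  proof -
    have "Q B = 0" if "B \<in> sets P" "B \<subseteq> A" for B
      using ac null_sets_subset[OF \<open>A \<in> null_sets P\<close> that(1,2)] by (simp add: signed_abs_cont_def)
    then have "(SUP B \<in> {B \<in> sets P. B \<subseteq> A}. ennreal (Q B)) \<le> 0"
      by (intro SUP_least) simp
    moreover have "A \<in> sets P" using that by blast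
    ultimately show ?thesis
      unfolding U_def emeasure_upper_variation[OF Q \<open>A \<in> sets P\<close>] by simp
  qed
  have acU: "absolutely_continuous P U"
    using U_null sU by (auto simp: absolutely_continuous_def)
  have acL: "absolutely_continuous P L"
    unfolding absolutely_continuous_def
  proof
    fix A assume A: "A \<in> null_sets P"
    then have "emeasure L A = 0"
      using U_null[OF A] ac unfolding eL[OF null_setsD2[OF A]]
      by (simp add: signed_abs_cont_def measure_def)
    then show "A \<in> null_sets L" using A sL by auto
  qed
  obtain u where u: "integrable P u" "\<And>A. A \<in> sets P \<Longrightarrow> measure U A = set_lebesgue_integral P A u"
    using finite_radon_nikodym[OF P U.finite_measure_axioms acU sU] by blast
  obtain l where l: "integrable P l" "\<And>A. A \<in> sets P \<Longrightarrow> measure L A = set_lebesgue_integral P A l"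
    using finite_radon_nikodym[OF P finL acL sL] by blast
  have "Q A = set_lebesgue_integral P A (\<lambda>x. u x - l x)" if A: "A \<in> sets P" for A
  proof -
    have si: "set_integrable P A u" "set_integrable P A l"
      using integrable_mult_indicator[OF A u(1)] integrable_mult_indicator[OF A l(1)]
      by (simp_all add: set_integrable_def)
    have "measure L A = measure U A - Q A"
      using A le by (simp add: measure_def eL)
    then have "Q A = set_lebesgue_integral P A u - set_lebesgue_integral P A l"
      using u(2)[OF A] l(2)[OF A] by linarith
    also have "\<dots> = set_lebesgue_integral P A (\<lambda>x. u x - l x)"
      using set_integral_diff(2)[OF si] by (rule sym)
    finally show ?thesis .
  qed
  moreover have "integrable P (\<lambda>x. u x - l x)" using u(1) l(1) by simp
  ultimately show ?thesis by blast
qed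

lemma signed_RN_deriv_density:
  assumes "finite_measure P" "signed_measure P Q" "signed_abs_cont P Q"
  shows "integrable P (signed_RN_deriv P Q)"
    and "\<And>A. A \<in> sets P \<Longrightarrow> Q A = set_lebesgue_integral P A (signed_RN_deriv P Q)"
proof -
  have "integrable P (signed_RN_deriv P Q) \<and> (\<forall>A \<in> sets P. Q A = set_lebesgue_integral P A (signed_RN_deriv P Q))"
    unfolding signed_RN_deriv_def by (rule someI_ex[OF signed_radon_nikodym[OF assms]])
  then show "integrable P (signed_RN_deriv P Q)"
    and "\<And>A. A \<in> sets P \<Longrightarrow> Q A = set_lebesgue_integral P A (signed_RN_deriv P Q)" by auto
qed

section \<open>Variations and integrals in terms of a density\<close>

lemma measure_of_eq_measure:
  assumes "sets N = sets M" "\<And>A. A \<in> sets M \<Longrightarrow> \<mu> A = emeasure N A"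
  shows "measure_of (space M) (sets M) \<mu> = N"
proof -
  have "measure_of (space M) (sets M) \<mu> = measure_of (space N) (sets N) (emeasure N)"
    unfolding sets_eq_imp_space_eq[OF assms(1)] assms(1)
    using assms(2) sets_eq_imp_space_eq[OF assms(1)]
    by (intro measure_of_eq) (auto simp: sets.space_closed sets.sigma_sets_eq dest: sets.sets_into_space)
  then show ?thesis by (simp add: measure_of_of_measure)
qed

text \<open>The set where the density is nonnegative attains the supremum. \<^const>\<open>ennreal\<close> truncates
  negative reals, so the density on the right-hand side is the positive part of \<open>q\<close>.\<close>

lemma upper_variation_density:
  assumes q: "integrable P q" and Q: "\<And>A. A \<in> sets P \<Longrightarrow> Q A = set_lebesgue_integral P A q"
  shows "upper_variation P Q = density P (\<lambda>x. ennreal (q x))"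
  unfolding upper_variation_def
proof (rule measure_of_eq_measure)
  fix A assume A[measurable]: "A \<in> sets P"
  have [measurable]: "q \<in> borel_measurable P" using q by simp
  let ?q = "\<lambda>x. max 0 (q x)"
  have qp: "integrable P ?q" using q by simp
  have e: "emeasure (density P (\<lambda>x. ennreal (q x))) B = ennreal (\<integral>x. indicator B x * ?q x \<partial>P)"
    if [measurable]: "B \<in> sets P" for B
  proof -
    have "emeasure (density P (\<lambda>x. ennreal (q x))) B = (\<integral>\<^sup>+ x. ennreal (indicator B x * ?q x) \<partial>P)"
      by (auto simp: emeasure_density indicator_def max_def ennreal_neg intro!: nn_integral_cong)
    also have "\<dots> = ennreal (\<integral>x. indicator B x * ?q x \<partial>P)"
      using integrable_mult_indicator[OF that qp] by (intro nn_integral_eq_integral) auto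
    finally show ?thesis .
  qed
  show "(SUP B \<in> {B \<in> sets P. B \<subseteq> A}. ennreal (Q B)) = emeasure (density P (\<lambda>x. ennreal (q x))) A"
  proof (intro antisym SUP_least)
    fix B assume "B \<in> {B \<in> sets P. B \<subseteq> A}"
    then have [measurable]: "B \<in> sets P" and "B \<subseteq> A" by auto
    have "Q B \<le> (\<integral>x. indicator B x * ?q x \<partial>P)"
      using integrable_mult_indicator[OF \<open>B \<in> sets P\<close> q] integrable_mult_indicator[OF \<open>B \<in> sets P\<close> qp]
      by (auto simp: Q set_lebesgue_integral_def intro!: integral_mono mult_left_mono)
    then have "ennreal (Q B) \<le> emeasure (density P (\<lambda>x. ennreal (q x))) B"
      by (simp add: e ennreal_leI)
    also have "\<dots> \<le> emeasure (density P (\<lambda>x. ennreal (q x))) A"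
      using \<open>B \<subseteq> A\<close> by (intro emeasure_mono) auto
    finally show "ennreal (Q B) \<le> emeasure (density P (\<lambda>x. ennreal (q x))) A" .
  next
    define B where "B = A \<inter> {x \<in> space P. 0 \<le> q x}"
    have B: "B \<in> sets P" "B \<subseteq> A" by (auto simp: B_def)
    have "Q B = (\<integral>x. indicator A x * ?q x \<partial>P)"
      using B(1) by (auto simp: Q set_lebesgue_integral_def B_def indicator_def intro!: Bochner_Integration.integral_cong)
    then have "emeasure (density P (\<lambda>x. ennreal (q x))) A = ennreal (Q B)" by (simp add: e)
    also have "\<dots> \<le> (SUP B \<in> {B \<in> sets P. B \<subseteq> A}. ennreal (Q B))"
      using B by (intro SUP_upper) auto
    finally show "emeasure (density P (\<lambda>x. ennreal (q x))) A \<le> (SUP B \<in> {B \<in> sets P. B \<subseteq> A}. ennreal (Q B))" .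
  qed
qed simp

lemma lower_variation_density:
  assumes q: "integrable P q" and Q: "\<And>A. A \<in> sets P \<Longrightarrow> Q A = set_lebesgue_integral P A q"
  shows "lower_variation P Q = density P (\<lambda>x. ennreal (- q x))"
  unfolding lower_variation_def
  by (rule upper_variation_density) (use assms in \<open>auto simp: set_lebesgue_integral_def\<close>)

lemma total_variation_density:
  assumes q: "integrable P q" and Q: "\<And>A. A \<in> sets P \<Longrightarrow> Q A = set_lebesgue_integral P A q"
  shows "total_variation P Q = density P (\<lambda>x. ennreal \<bar>q x\<bar>)"
  unfolding total_variation_def
proof (rule measure_of_eq_measure)
  fix A assume [measurable]: "A \<in> sets P"
  have [measurable]: "q \<in> borel_measurable P" using q by simp
  have "emeasure (upper_variation P Q) A + emeasure (lower_variation P Q) A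
      = (\<integral>\<^sup>+ x. ennreal (q x) * indicator A x + ennreal (- q x) * indicator A x \<partial>P)"
    by (simp add: upper_variation_density[OF assms] lower_variation_density[OF assms] emeasure_density nn_integral_add)
  also have "\<dots> = emeasure (density P (\<lambda>x. ennreal \<bar>q x\<bar>)) A"
    by (auto simp: emeasure_density abs_real_def ennreal_neg intro!: nn_integral_cong)
  finally show "emeasure (upper_variation P Q) A + emeasure (lower_variation P Q) A
      = emeasure (density P (\<lambda>x. ennreal \<bar>q x\<bar>)) A" .
qed simp

lemma signed_integral_density:
  assumes q: "integrable P q" and Q: "\<And>A. A \<in> sets P \<Longrightarrow> Q A = set_lebesgue_integral P A q"
    and f[measurable]: "f \<in> borel_measurable P" and fq: "integrable P (\<lambda>x. f x * q x)"
  shows "signed_integral P Q f = (\<integral>x. f x * q x \<partial>P)"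
proof -
  have [measurable]: "q \<in> borel_measurable P" using q by simp
  have int: "integrable P (\<lambda>x. max 0 (q x) * f x)" "integrable P (\<lambda>x. max 0 (- q x) * f x)"
    by (auto intro!: Bochner_Integration.integrable_bound[OF fq] AE_I2 simp: abs_mult max_def mult_nonneg_nonpos)
  have "signed_integral P Q f = (\<integral>x. max 0 (q x) * f x \<partial>P) - (\<integral>x. max 0 (- q x) * f x \<partial>P)"
    using integral_density[of f P "\<lambda>x. max 0 (q x)"] integral_density[of f P "\<lambda>x. max 0 (- q x)"]
      upper_variation_density[OF q Q] lower_variation_density[OF q Q]
    by (simp add: signed_integral_def)
  also have "\<dots> = (\<integral>x. max 0 (q x) * f x - max 0 (- q x) * f x \<partial>P)"
    using int by simp
  also have "\<dots> = (\<integral>x. f x * q x \<partial>P)"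
    by (intro Bochner_Integration.integral_cong) (auto simp: max_def)
  finally show ?thesis .
qed

text \<open>Members of \<open>F\<close> are integrable for the total variation by hypothesis, bounded functions because the
  total variation is finite; integrability passes to linear combinations.\<close>

lemma fun_span_integrable:
  assumes q: "integrable P q" and Q: "\<And>A. A \<in> sets P \<Longrightarrow> Q A = set_lebesgue_integral P A q"
    and F: "F \<subseteq> borel_measurable P" "Q \<in> signed_measures_integrating P F"
    and f: "f \<in> fun_span (F \<union> bounded_measurable P)"
  shows "f \<in> borel_measurable P \<and> integrable P (\<lambda>x. f x * q x)"
proof -
  let ?S = "{f. f \<in> borel_measurable P \<and> integrable P (\<lambda>x. f x * q x)}"
  interpret fm: module "\<lambda>(c::real) (f::'a \<Rightarrow> real) x. c * f x"
    by standard (auto simp: fun_eq_iff algebra_simps)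
  have [measurable]: "q \<in> borel_measurable P" using q by simp
  have "F \<subseteq> ?S"
  proof
    fix g assume "g \<in> F"
    then have [measurable]: "g \<in> borel_measurable P"
      and "(\<integral>\<^sup>+ x. ennreal \<bar>g x\<bar> \<partial>total_variation P Q) < \<infinity>"
      using F by (auto simp: signed_measures_integrating_def)
    then have "(\<integral>\<^sup>+ x. ennreal \<bar>q x\<bar> * ennreal \<bar>g x\<bar> \<partial>P) < \<infinity>"
      by (simp add: total_variation_density[OF q Q] nn_integral_density)
    then show "g \<in> ?S"
      by (simp add: integrable_iff_bounded abs_mult ennreal_mult mult.commute)
  qed
  moreover have "bounded_measurable P \<subseteq> ?S"
  proof
    fix g assume "g \<in> bounded_measurable P"
    then obtain K where [measurable]: "g \<in> borel_measurable P" and K: "\<And>x. x \<in> space P \<Longrightarrow> \<bar>g x\<bar> \<le> K"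
      by (auto simp: bounded_measurable_def bounded_iff)
    have "integrable P (\<lambda>x. K * q x)" using q by simp
    then have "integrable P (\<lambda>x. g x * q x)"
      by (rule Bochner_Integration.integrable_bound)
        (auto simp: abs_mult intro!: AE_I2 mult_right_mono order_trans[OF K])
    then show "g \<in> ?S" by simp
  qed
  moreover have "fm.subspace ?S"
    by (auto simp: fm.subspace_def distrib_right mult.assoc plus_fun_def zero_fun_def)
  ultimately have "fun_span (F \<union> bounded_measurable P) \<subseteq> ?S"
    unfolding fun_span_def by (intro fm.span_minimal) auto
  with f show ?thesis by blast
qed

section \<open>The duality gap\<close>

text \<open>With an integrable minorant \<open>k\<close> the negative part of \<open>c\<close> has finite integral, so
  \<^const>\<open>ereal_integral\<close> is the genuine integral, possibly \<open>\<infinity>\<close>, and is additive along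
  \<open>c = k + (c - k)\<close>. Since the integrals may be infinite, the identity is integrated in a form with
  nonnegative terms only: \<open>c\<^sup>+ + k\<^sup>- = c\<^sup>- + k\<^sup>+ + (c - k)\<close>.\<close>

lemma ereal_integral_above_integrable:
  assumes c[measurable]: "c \<in> borel_measurable M" and k: "integrable M k"
    and le: "AE x in M. ereal (k x) \<le> c x"
  shows "ereal_integral M c =
    ereal (\<integral>x. k x \<partial>M) + enn2ereal (\<integral>\<^sup>+ x. e2ennreal (c x - ereal (k x)) \<partial>M)"
proof -
  have [measurable]: "k \<in> borel_measurable M" using k by simp
  define A where "A = (\<integral>\<^sup>+ x. e2ennreal (c x) \<partial>M)"
  define B where "B = (\<integral>\<^sup>+ x. e2ennreal (- c x) \<partial>M)"
  define N where "N = (\<integral>\<^sup>+ x. e2ennreal (c x - ereal (k x)) \<partial>M)"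
  define Kp where "Kp = (\<integral>\<^sup>+ x. ennreal (k x) \<partial>M)"
  define Kn where "Kn = (\<integral>\<^sup>+ x. ennreal (- k x) \<partial>M)"
  have K_fin: "Kp < \<infinity>" "Kn < \<infinity>"
    using k by (auto simp: Kp_def Kn_def real_integrable_def less_top)
  have "B \<le> Kn"
    unfolding B_def Kn_def
  proof (rule nn_integral_mono_AE)
    show "AE x in M. e2ennreal (- c x) \<le> ennreal (- k x)"
      using le
    proof eventually_elim
      case (elim x)
      then have "- c x \<le> ereal (- k x)" by (cases "c x") auto
      from e2ennreal_mono[OF this] show ?case by simp
    qed
  qed
  then have B_fin: "B < \<infinity>" using K_fin(2) by (rule le_less_trans)
  have pointwise: "e2ennreal (c x) + ennreal (- k x) = e2ennreal (- c x) + ennreal (k x) + e2ennreal (c x - ereal (k x))"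
    if "ereal (k x) \<le> c x" for x
  proof (cases "c x")
    case (real r)
    with that have "k x \<le> r" by simp
    with real show ?thesis
      by (cases "0 \<le> r"; cases "0 \<le> k x") (simp_all add: ennreal_neg ennreal_plus[symmetric] del: ennreal_plus)
  qed (use that in auto)
  have "A + Kn = (\<integral>\<^sup>+ x. e2ennreal (c x) + ennreal (- k x) \<partial>M)"
    by (simp add: A_def Kn_def nn_integral_add)
  also have "\<dots> = (\<integral>\<^sup>+ x. e2ennreal (- c x) + ennreal (k x) + e2ennreal (c x - ereal (k x)) \<partial>M)"
    using le by (intro nn_integral_cong_AE) (auto elim!: eventually_mono intro: pointwise)
  also have "\<dots> = B + Kp + N"
    by (simp add: B_def Kp_def N_def nn_integral_add)
  finally have eq: "A + Kn = B + Kp + N" .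
  obtain b p n where bpn: "B = ennreal b" "0 \<le> b" "Kp = ennreal p" "0 \<le> p" "Kn = ennreal n" "0 \<le> n"
    using B_fin K_fin by (cases B; cases Kp; cases Kn) auto
  have int_k: "(\<integral>x. k x \<partial>M) = p - n"
    using real_lebesgue_integral_def[OF k] bpn by (simp add: Kp_def[symmetric] Kn_def[symmetric])
  have "enn2ereal A - enn2ereal B = ereal (p - n) + enn2ereal N"
  proof (cases A)
    case (real a)
    with eq bpn obtain m where m: "N = ennreal m" "0 \<le> m"
      by (cases N) (auto simp: ennreal_plus[symmetric] simp del: ennreal_plus)
    with eq bpn real have "a + n = b + p + m"
      by (simp add: ennreal_plus[symmetric] del: ennreal_plus)
    then show ?thesis using real m bpn by (simp add: enn2ereal_ennreal)
  next
    case top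
    with eq bpn have "N = top" by (cases N) (auto simp: ennreal_plus[symmetric] simp del: ennreal_plus)
    then show ?thesis using top bpn by (simp add: enn2ereal_ennreal)
  qed
  then show ?thesis by (simp add: ereal_integral_def A_def B_def N_def int_k)
qed

text \<open>The minorant is \<open>f q - \<phi>(q)\<close>, by the Fenchel-Young inequality. The gap is the integral of the
  nonnegative slack in that inequality, so this identity contains weak duality, and optimality
  of \<open>f\<close> becomes the vanishing of a nonnegative integrand.\<close>

lemma duality_gap:
  assumes df: "divergence_function \<phi>"
    and q: "q \<in> borel_measurable P" "(\<integral>\<^sup>+ x. \<phi> (q x) \<partial>P) < \<infinity>"
    and f[measurable]: "f \<in> borel_measurable P" and fq: "integrable P (\<lambda>x. f x * q x)"
  shows "ereal (\<integral>x. f x * q x \<partial>P) - ereal_integral P (\<lambda>x. conjugate \<phi> (f x)) =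
      enn2ereal (\<integral>\<^sup>+ x. \<phi> (q x) \<partial>P)
      - enn2ereal (\<integral>\<^sup>+ x. e2ennreal (conjugate \<phi> (f x) - ereal (f x * q x - enn2real (\<phi> (q x)))) \<partial>P)"
proof -
  have cvx: "ennreal_convex \<phi>" using df by (simp add: divergence_function_def)
  have [measurable]: "(\<lambda>x. \<phi> (q x)) \<in> borel_measurable P" "(\<lambda>x. conjugate \<phi> (f x)) \<in> borel_measurable P"
    "q \<in> borel_measurable P"
    using q(1) measurable_compose[OF q(1) ennreal_convex_borel[OF cvx]] measurable_compose[OF f conjugate_borel]
    by auto
  have fin: "AE x in P. \<phi> (q x) < \<infinity>"
    using nn_integral_noteq_infinite[of "\<lambda>x. \<phi> (q x)" P] q(2) by (auto simp: less_top)
  define h where "h x = enn2real (\<phi> (q x))" for x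
  have [measurable]: "h \<in> borel_measurable P" unfolding h_def[abs_def] by measurable
  have I: "(\<integral>\<^sup>+ x. \<phi> (q x) \<partial>P) = (\<integral>\<^sup>+ x. ennreal (h x) \<partial>P)"
    using fin by (intro nn_integral_cong_AE) (auto simp: h_def)
  have h: "integrable P h"
    using q(2) I by (intro integrableI_nonneg) (auto simp: h_def)
  have "ereal_integral P (\<lambda>x. conjugate \<phi> (f x)) = ereal (\<integral>x. f x * q x - h x \<partial>P)
      + enn2ereal (\<integral>\<^sup>+ x. e2ennreal (conjugate \<phi> (f x) - ereal (f x * q x - h x)) \<partial>P)"
  proof (rule ereal_integral_above_integrable)
    show "AE x in P. ereal (f x * q x - h x) \<le> conjugate \<phi> (f x)"
      using fin by eventually_elim (unfold h_def, rule fenchel_young)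
  qed (use fq h in auto)
  also have "(\<integral>x. f x * q x - h x \<partial>P) = (\<integral>x. f x * q x \<partial>P) - (\<integral>x. h x \<partial>P)"
    using fq h by simp
  finally have eq: "ereal_integral P (\<lambda>x. conjugate \<phi> (f x)) = ereal ((\<integral>x. f x * q x \<partial>P) - (\<integral>x. h x \<partial>P))
      + enn2ereal (\<integral>\<^sup>+ x. e2ennreal (conjugate \<phi> (f x) - ereal (f x * q x - h x)) \<partial>P)" .
  have "enn2ereal (\<integral>\<^sup>+ x. \<phi> (q x) \<partial>P) = ereal (\<integral>x. h x \<partial>P)"
  proof -
    have nn: "0 \<le> h x" for x by (simp add: h_def)
    then have "(\<integral>\<^sup>+ x. \<phi> (q x) \<partial>P) = ennreal (\<integral>x. h x \<partial>P)"
      using h by (simp add: I nn_integral_eq_integral)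
    then show ?thesis using nn by (simp add: enn2ereal_ennreal)
  qed
  moreover have "ereal a - (ereal (a - b) + enn2ereal N) = ereal b - enn2ereal N" for a b N
    by (cases "enn2ereal N") auto
  ultimately show ?thesis unfolding eq h_def by simp
qed

lemma gap_eq_0_iff:
  assumes df: "divergence_function \<phi>"
    and q: "q \<in> borel_measurable P" "(\<integral>\<^sup>+ x. \<phi> (q x) \<partial>P) < \<infinity>"
    and f[measurable]: "f \<in> borel_measurable P"
  shows "(\<integral>\<^sup>+ x. e2ennreal (conjugate \<phi> (f x) - ereal (f x * q x - enn2real (\<phi> (q x)))) \<partial>P) = 0
      \<longleftrightarrow> (AE x in P. \<phi> (q x) < \<infinity> \<and> subgradient \<phi> (q x) (f x))"
proof -
  have cvx: "ennreal_convex \<phi>" using df by (simp add: divergence_function_def)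
  have [measurable]: "(\<lambda>x. \<phi> (q x)) \<in> borel_measurable P" "(\<lambda>x. conjugate \<phi> (f x)) \<in> borel_measurable P"
    "q \<in> borel_measurable P"
    using q(1) measurable_compose[OF q(1) ennreal_convex_borel[OF cvx]] measurable_compose[OF f conjugate_borel]
    by auto
  have fin: "AE x in P. \<phi> (q x) < \<infinity>"
    using nn_integral_noteq_infinite[of "\<lambda>x. \<phi> (q x)" P] q(2) by (auto simp: less_top)
  have *: "e2ennreal (conjugate \<phi> (f x) - ereal (f x * q x - enn2real (\<phi> (q x)))) = 0
      \<longleftrightarrow> subgradient \<phi> (q x) (f x)" if "\<phi> (q x) < \<infinity>" for x
  proof -
    have "e2ennreal (c - ereal k) = 0 \<longleftrightarrow> c = ereal k" if "ereal k \<le> c" for c k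
      using that by (cases c) (auto simp: ennreal_eq_0_iff)
    from this[OF fenchel_young[of \<phi> "q x" "f x", OF that]] fenchel_equality_iff[of \<phi> "q x" "f x", OF that]
    show ?thesis by simp
  qed
  have "(\<integral>\<^sup>+ x. e2ennreal (conjugate \<phi> (f x) - ereal (f x * q x - enn2real (\<phi> (q x)))) \<partial>P) = 0
      \<longleftrightarrow> (AE x in P. e2ennreal (conjugate \<phi> (f x) - ereal (f x * q x - enn2real (\<phi> (q x)))) = 0)"
    by (intro nn_integral_0_iff_AE) simp
  also have "\<dots> \<longleftrightarrow> (AE x in P. \<phi> (q x) < \<infinity> \<and> subgradient \<phi> (q x) (f x))"
    using fin * by (intro iffI; (elim AE_mp)?) (auto elim!: eventually_mono)
  finally show ?thesis .
qed

theorem theorem4p4: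
  fixes P :: "'a measure" and \<phi> :: "real \<Rightarrow> ennreal" and F :: "('a \<Rightarrow> real) set"
    and Q :: "'a set \<Rightarrow> real" and fbar :: "'a \<Rightarrow> real"
  assumes "prob_space P"
    and "divergence_function \<phi>"
    and "F \<subseteq> borel_measurable P"
    and "differentiable_on_dom \<phi>"
    and "Q \<in> signed_measures_integrating P F"
    and "phi_divergence \<phi> Q P < \<infinity>"
    and "fbar \<in> fun_span (F \<union> bounded_measurable P)"
    and "AE x in P. ereal (fbar x) = ext_deriv \<phi> (signed_RN_deriv P Q x)"
  shows "enn2ereal (phi_divergence \<phi> Q P) =
           (SUP f \<in> fun_span (F \<union> bounded_measurable P).
              ereal (signed_integral P Q f) - ereal_integral P (\<lambda>x. conjugate \<phi> (f x)))
         \<and> dual_optimal \<phi> P F Q fbar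
         \<and> (essentially_smooth \<phi> \<longrightarrow>
              (\<forall>f. dual_optimal \<phi> P F Q f \<longrightarrow> (AE x in P. f x = fbar x)))"
proof -
  interpret prob_space P by fact
  let ?S = "fun_span (F \<union> bounded_measurable P)"
  define q where "q = signed_RN_deriv P Q"
  have Q: "signed_measure P Q" using assms(5) by (simp add: signed_measures_integrating_def)
  have ac: "signed_abs_cont P Q"
    using assms(6) by (auto simp: phi_divergence_def split: if_splits)
  have q: "integrable P q" "\<And>A. A \<in> sets P \<Longrightarrow> Q A = set_lebesgue_integral P A q"
    unfolding q_def using signed_RN_deriv_density[OF finite_measure_axioms Q ac] by auto
  have qm: "q \<in> borel_measurable P" using q(1) by simp
  define D where "D = phi_divergence \<phi> Q P"
  have D: "D = (\<integral>\<^sup>+ x. \<phi> (q x) \<partial>P)" using ac by (simp add: D_def phi_divergence_def q_def)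
  have D_fin: "D < \<infinity>" using assms(6) by (simp add: D_def)
  define gap where "gap f = (\<integral>\<^sup>+ x. e2ennreal (conjugate \<phi> (f x) - ereal (f x * q x - enn2real (\<phi> (q x)))) \<partial>P)" for f
  have S: "f \<in> borel_measurable P" "integrable P (\<lambda>x. f x * q x)" if "f \<in> ?S" for f
    using fun_span_integrable[OF q assms(3,5) that] by auto
  have obj: "dual_objective \<phi> P Q f = enn2ereal D - enn2ereal (gap f)" if "f \<in> ?S" for f
    using duality_gap[OF assms(2) qm D_fin[unfolded D] S[OF that]] signed_integral_density[OF q S[OF that]]
    by (simp add: dual_objective_def gap_def D)
  have gap0: "gap f = 0 \<longleftrightarrow> (AE x in P. \<phi> (q x) < \<infinity> \<and> subgradient \<phi> (q x) (f x))" if "f \<in> ?S" for f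
    unfolding gap_def by (rule gap_eq_0_iff[OF assms(2) qm D_fin[unfolded D] S(1)[OF that]])
  obtain d where d: "D = ennreal d" "0 \<le> d" using D_fin by (cases D) auto
  have obj_le: "dual_objective \<phi> P Q f \<le> enn2ereal D" if "f \<in> ?S" for f
    using obj[OF that] d by (cases "gap f") (auto simp: enn2ereal_ennreal)
  have obj_eq: "dual_objective \<phi> P Q f = enn2ereal D \<longleftrightarrow> gap f = 0" if "f \<in> ?S" for f
    using obj[OF that] d by (cases "gap f") (auto simp: enn2ereal_ennreal ennreal_eq_0_iff)
  have fin: "AE x in P. \<phi> (q x) < \<infinity>"
    using nn_integral_noteq_infinite[of "\<lambda>x. \<phi> (q x)" P] D_fin[unfolded D] assms(2)
      measurable_compose[OF qm ennreal_convex_borel] by (auto simp: less_top divergence_function_def)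
  have "gap fbar = 0"
    unfolding gap0[OF assms(7)] using fin assms(8)
    by eventually_elim (use ext_deriv_subgradient[OF assms(2,4)] in \<open>auto simp: q_def\<close>)
  then have attained: "dual_objective \<phi> P Q fbar = enn2ereal D"
    using obj_eq assms(7) by blast
  then have sup: "(SUP f \<in> ?S. dual_objective \<phi> P Q f) = enn2ereal D"
    using obj_le assms(7) by (intro antisym SUP_least) (auto intro: SUP_upper2)
  have "AE x in P. f x = fbar x" if "essentially_smooth \<phi>" "dual_optimal \<phi> P F Q f" for f
  proof -
    have "f \<in> ?S" "dual_objective \<phi> P Q f = enn2ereal D"
      using that(2) by (auto simp: dual_optimal_def sup)
    then have "AE x in P. \<phi> (q x) < \<infinity> \<and> subgradient \<phi> (q x) (f x)"
      using obj_eq gap0 by blast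
    then show ?thesis using assms(8)
    proof eventually_elim
      case (elim x)
      show ?case
        by (rule essentially_smooth_unique_subgradient[OF assms(2) that(1)])
          (use elim in \<open>auto simp: q_def\<close>)
    qed
  qed
  then show ?thesis
    using attained sup assms(7) by (auto simp: dual_optimal_def dual_objective_def D_def)
qed

end
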